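(* Suppose that $F \in \mathcal{H}_2$ is Lipschitz continuous with Lipschitz constant $L>1$ and that for each $\epsilon>0$ the constants $\eta,R>0$ are chosen such that $L\eta\le R\le\epsilon$. Then $$\lim_{n\to\infty,\ \epsilon\to0} \mathrm{d}_{\mathrm{H}}(Q_n^*,\varrho(F))=0,$$ in the sense that for all $\delta>0$ there exist $\epsilon_0>0$ and $n_0\in\mathbb{N}$ such that, if the box diameter bound $\epsilon$ satisfies $\epsilon\in(0,\epsilon_0]$ and $n\ge n_0$, then $\mathrm{d}_{\mathrm{H}}(Q_n^*,\varrho(F))<\delta$. Here, for each $\epsilon>0$, $Q_n^*$ denotes the output of the box algorithm described in the context, run with the parameters $\epsilon,\eta,R$.
   Context: $\mathbb{T}^2=\mathbb{R}^2/\mathbb{Z}^2$, and $\mathcal{H}_2$ is the set of all lifts $F:\mathbb{R}^2\to\mathbb{R}^2$ of homeomorphisms of $\mathbb{T}^2$ homotopic to the identity; equivalently, $F$ is a homeomorphism of $\mathbb{R}^2$ with $F(x+k)=F(x)+k$ for all $x\in\mathbb{R}^2$, $k\in\mathbb{Z}^2$. $d$ is the Euclidean distance (and $d(x,B)$ the distance from a point to a set), and $\mathrm{d}_{\mathrm{H}}$ is the Hausdorff distance of subsets of $\mathbb{R}^2$. Rotation set: $\varrho(F)$ is the set of all $v\in\mathbb{R}^2$ for which there exist integers $n_i\nearrow\infty$ and points $x_i\in\mathbb{R}^2$ with $\lim_{i\to\infty}\frac{F^{n_i}(x_i)-x_i}{n_i}=v$. Box algorithm with parameters $\epsilon,\eta,R>0$: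 let $\mathcal{B}_0$ be a collection of compact sets (boxes) $B\subset[0,1]^2$ with $\sup_{B\in\mathcal{B}_0}\mathrm{diam}(B)\le\epsilon$ and $\bigcup_{B\in\mathcal{B}_0}B=[0,1]^2$. Let $\mathcal{B}=\{B+t : B\in\mathcal{B}_0,\ t\in\mathbb{Z}^2\}$. For each $B\in\mathcal{B}$ let $\Gamma_B\subseteq B$ be a finite set that is $\eta$-dense in $B$ (every point of $B$ is within distance $\eta$ of some point of $\Gamma_B$), chosen such that $\Gamma_{B+t}=\Gamma_B+t$ for every $t\in\mathbb{Z}^2$. For $B\in\mathcal{B}$ define the box image $\mathcal{I}(B)=\{B'\in\mathcal{B} : \exists x\in\Gamma_B \text{ with } d(F(x),B')\le R\}$. Put $Q_0=[0,1]^2$ and, for $k\ge0$, $\mathcal{B}_{k+1}=\{B'\in\mathcal{B} : \exists B\in\mathcal{B}_k \text{ with } B'\in\mathcal{I}(B)\}$ and $Q_{k+1}=\bigcup_{B\in\mathcal{B}_{k+1}}B$. Finally $Q_n^*=\frac1n Q_n$ for $n\in\mathbb{N}$. *)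

theory Defs
  imports "HOL-Analysis.Analysis"
begin

definition int_lattice :: "(real^2) set" where
  "int_lattice = {t. \<forall>i. t $ i \<in> \<int>}"

definition unit_square :: "(real^2) set" where
  "unit_square = cbox 0 1"

(* Lifts to the plane of torus homeomorphisms homotopic to the identity, described
   as the plane homeomorphisms that commute with all integer translations. *)
definition torus_lifts :: "(real^2 \<Rightarrow> real^2) set" where
  "torus_lifts = {F. (\<exists>G. homeomorphism UNIV UNIV F G) \<and>
                     (\<forall>x. \<forall>k\<in>int_lattice. F (x + k) = F x + k)}"

definition rotation_set :: "(real^2 \<Rightarrow> real^2) \<Rightarrow> (real^2) set" where
  "rotation_set F = {v. \<exists>(n :: nat \<Rightarrow> nat) (x :: nat \<Rightarrow> real^2).
      mono n \<and> filterlim n at_top sequentially \<and>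
      (\<lambda>i. ((F ^^ n i) (x i) - x i) /\<^sub>R real (n i)) \<longlonglongrightarrow> v}"

(* Values in [0,\<infinity>], so that no convention for empty or unbounded sets enters:
   the distance between an empty and a nonempty set, for instance, is \<infinity>. *)
definition hausdorff_distance :: "'a::metric_space set \<Rightarrow> 'a set \<Rightarrow> ennreal" where
  "hausdorff_distance A B =
     max (SUP a\<in>A. INF b\<in>B. ennreal (dist a b)) (SUP b\<in>B. INF a\<in>A. ennreal (dist a b))"

definition box_cover :: "real \<Rightarrow> (real^2) set set \<Rightarrow> bool" where
  "box_cover \<epsilon> \<B>\<^sub>0 \<longleftrightarrow>
     (\<forall>B\<in>\<B>\<^sub>0. compact B \<and> B \<subseteq> unit_square \<and> diameter B \<le> \<epsilon>) \<and> \<Union>\<B>\<^sub>0 = unit_square"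

definition box_translates :: "(real^2) set set \<Rightarrow> (real^2) set set" where
  "box_translates \<B>\<^sub>0 = {(+) t ` B | t B. t \<in> int_lattice \<and> B \<in> \<B>\<^sub>0}"

definition grid_choice ::
    "real \<Rightarrow> (real^2) set set \<Rightarrow> ((real^2) set \<Rightarrow> (real^2) set) \<Rightarrow> bool" where
  "grid_choice \<eta> \<B>\<^sub>0 \<Gamma> \<longleftrightarrow>
     (\<forall>B\<in>box_translates \<B>\<^sub>0.
        finite (\<Gamma> B) \<and> \<Gamma> B \<subseteq> B \<and>
        (\<forall>y\<in>B. \<exists>x\<in>\<Gamma> B. dist y x \<le> \<eta>) \<and>
        (\<forall>t\<in>int_lattice. \<Gamma> ((+) t ` B) = (+) t ` \<Gamma> B))"

(* The library sets infdist x {} = 0, whereas here an empty box is at infinite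
   distance from every point; hence the nonemptiness condition. *)
definition box_image ::
    "(real^2 \<Rightarrow> real^2) \<Rightarrow> real \<Rightarrow> (real^2) set set \<Rightarrow> ((real^2) set \<Rightarrow> (real^2) set)
      \<Rightarrow> (real^2) set \<Rightarrow> (real^2) set set" where
  "box_image F R \<B>\<^sub>0 \<Gamma> B =
     {B' \<in> box_translates \<B>\<^sub>0. B' \<noteq> {} \<and> (\<exists>x\<in>\<Gamma> B. infdist (F x) B' \<le> R)}"

fun box_level ::
    "(real^2 \<Rightarrow> real^2) \<Rightarrow> real \<Rightarrow> (real^2) set set \<Rightarrow> ((real^2) set \<Rightarrow> (real^2) set)
      \<Rightarrow> nat \<Rightarrow> (real^2) set set" where
  "box_level F R \<B>\<^sub>0 \<Gamma> 0 = \<B>\<^sub>0"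
| "box_level F R \<B>\<^sub>0 \<Gamma> (Suc k) =
     {B' \<in> box_translates \<B>\<^sub>0. \<exists>B\<in>box_level F R \<B>\<^sub>0 \<Gamma> k. B' \<in> box_image F R \<B>\<^sub>0 \<Gamma> B}"

fun box_union ::
    "(real^2 \<Rightarrow> real^2) \<Rightarrow> real \<Rightarrow> (real^2) set set \<Rightarrow> ((real^2) set \<Rightarrow> (real^2) set)
      \<Rightarrow> nat \<Rightarrow> (real^2) set" where
  "box_union F R \<B>\<^sub>0 \<Gamma> 0 = unit_square"
| "box_union F R \<B>\<^sub>0 \<Gamma> (Suc k) = \<Union>(box_level F R \<B>\<^sub>0 \<Gamma> (Suc k))"

definition scaled_box_union ::
    "(real^2 \<Rightarrow> real^2) \<Rightarrow> real \<Rightarrow> (real^2) set set \<Rightarrow> ((real^2) set \<Rightarrow> (real^2) set)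
      \<Rightarrow> nat \<Rightarrow> (real^2) set" where
  "scaled_box_union F R \<B>\<^sub>0 \<Gamma> n = (\<lambda>x. x /\<^sub>R real n) ` box_union F R \<B>\<^sub>0 \<Gamma> n"

end

theory Submission
  imports Defs
begin

text \<open>Both inclusions behind the Hausdorff estimate go through pseudo-orbits. Every orbit starting in
  the unit square stays in the box unions (\<open>orbit_in_box_union\<close>), and conversely every point of
  the \<open>n\<close>-th box union is the end of a pseudo-orbit of length \<open>n\<close> with jumps of size at most
  \<open>R + \<epsilon> \<le> 2\<epsilon>\<close> (\<open>box_union_reached_by_pseudo_orbit\<close>). So it has to be shown that mean
  speeds of long pseudo-orbits with small jumps are close to rotation vectors, and that each
  rotation vector is approximated at every large time by orbits from the fundamental square \<open>D\<close>.

  Cutting a long pseudo-orbit into blocks of fixed length \<open>N\<close> exhibits its mean speed as an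
  average of \<open>N\<close>-step speeds, that is, almost as an element of the convex hull of
  \<open>F\<^sup>N(D)/N\<close>. Averages of speeds need not be speeds in general; what makes them so here is
  planar topology, namely that \<open>F\<^sup>N(D)/N\<close> is convex up to an error tending to zero
  (\<open>iterated_square_almost_convex\<close>). This plays the part of the theorem of Misiurewicz and
  Ziemian on convexity of rotation sets in dimension two.

  The almost convexity rests on the fact that the midpoint of two points of \<open>G(D)\<close> is within
  distance 1 of \<open>G(D)\<close> for every lift \<open>G\<close> (\<open>midpoint_near_image\<close>). It comes from a winding
  argument (\<open>path_avoiding_midpoint_has_chord\<close>): a planar path from \<open>a\<close> to \<open>b\<close> that keeps away
  from the midpoint has every vector near \<open>(b - a)/2\<close> as a chord. One of these vectors is a lattice
  vector, but injectivity of \<open>G\<close> forbids nonzero lattice chords inside \<open>G(D)\<close>. Repeated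
  bisection and Caratheodory's theorem pass from midpoints to convex hulls
  (\<open>midpoint_approx_imp_hull_approx\<close>).

  With almost convexity, the speeds of all pseudo-orbits that are long enough lie near
  \<open>F\<^sup>N(D)/N\<close> (\<open>pseudo_orbit_speed\<close>). Applied to true orbits this puts the rotation set near
  \<open>F\<^sup>N(D)/N\<close> for all large \<open>N\<close>; conversely \<open>F\<^sup>N(D)/N\<close> is near the rotation set for large
  \<open>N\<close> by compactness. In both estimates the thresholds are independent of the boxes and grids,
  which gives the uniformity in \<open>\<epsilon>\<close> and \<open>n\<close>.\<close>

section \<open>Lattice chords of planar paths\<close>

text \<open>The difference of the two logarithms is continuous with values in the discrete set
  \<open>2\<pi>\<i>\<int>\<close>, hence constant. This is the only form in which winding numbers of
  non-closed paths enter the proof: an increment of \<open>f\<close> does not depend on the branch.\<close>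
lemma log_branches_same_increment:
  fixes f g :: "'a::topological_space \<Rightarrow> complex"
  assumes S: "connected S" and f: "continuous_on S f" and g: "continuous_on S g"
    and eq: "\<And>x. x \<in> S \<Longrightarrow> exp (f x) = exp (g x)"
    and xy: "x \<in> S" "y \<in> S"
  shows "f x - f y = g x - g y"
proof -
  define h where "h = (\<lambda>x. f x - g x)"
  have one: "exp (h x) = 1" if "x \<in> S" for x
    using eq[OF that] by (simp add: h_def exp_diff)
  have "h constant_on S"
  proof (rule continuous_discrete_range_constant[OF S])
    show "continuous_on S h" unfolding h_def by (intro continuous_intros f g)
    fix x assume x: "x \<in> S"
    show "\<exists>e>0. \<forall>y. y \<in> S \<and> h y \<noteq> h x \<longrightarrow> e \<le> norm (h y - h x)"
    proof (intro exI conjI allI impI)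
      show "(0::real) < 2 * pi" by simp
      fix y assume y: "y \<in> S \<and> h y \<noteq> h x"
      have "exp (h y - h x) = 1" using one x y by (simp add: exp_diff)
      then obtain n :: int where n: "Re (h y - h x) = 0" "Im (h y - h x) = of_int (2 * n) * pi"
        by (auto simp: exp_eq_1)
      have "n \<noteq> 0" using n y by (auto simp: complex_eq_iff)
      hence "1 \<le> \<bar>real_of_int n\<bar>" by linarith
      hence "2 * pi * 1 \<le> 2 * pi * \<bar>real_of_int n\<bar>" by (intro mult_left_mono) auto
      also have "\<dots> = \<bar>Im (h y - h x)\<bar>" using n by (simp add: abs_mult)
      also have "\<dots> \<le> norm (h y - h x)" by (rule abs_Im_le_cmod)
      finally show "2 * pi \<le> norm (h y - h x)" by simp
    qed
  qed
  hence "h x = h y" using xy by (auto simp: constant_on_def)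
  thus ?thesis by (simp add: h_def algebra_simps)
qed

text \<open>A vector version of the universal chord theorem, proved in Hopf's manner. If \<open>k\<close> were not a
  chord, \<open>\<phi>(s,t) = \<gamma>(t) - \<gamma>(s) - k\<close> would have a continuous logarithm on the triangle
  \<open>0 \<le> s \<le> t \<le> 1\<close>, so its argument would have total change zero along the boundary. On the
  diagonal \<open>\<phi>\<close> is constant. On the other two sides it is, up to sign, \<open>\<gamma>\<close> seen from the two
  points \<open>m + w\<close> and \<open>m - w\<close>, symmetric about the midpoint \<open>m\<close> of the end points. Since
  \<open>\<gamma>\<close> stays farther than \<open>|w|\<close> from \<open>m\<close>, both points can be moved to \<open>m\<close>; the resulting
  corrections cancel by symmetry, and the total change is twice the change of the argument of
  \<open>\<gamma> - m\<close>. But \<open>\<gamma> - m\<close> goes from a nonzero vector to its negative, so this change is an odd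
  multiple of \<open>\<pi>\<close> and not zero.\<close>
lemma path_avoiding_midpoint_has_chord:
  fixes \<gamma> :: "real \<Rightarrow> complex" and k :: complex
  assumes cont: "continuous_on {0..1} \<gamma>"
    and far: "\<And>t. t \<in> {0..1} \<Longrightarrow>
                norm (k - (\<gamma> 1 - \<gamma> 0) / 2) < norm (\<gamma> t - (\<gamma> 0 + \<gamma> 1) / 2)"
  shows "\<exists>s t. 0 \<le> s \<and> s \<le> t \<and> t \<le> 1 \<and> \<gamma> t - \<gamma> s = k"
proof (rule ccontr)
  assume "\<not> ?thesis"
  hence nochord: "\<gamma> t - \<gamma> s - k \<noteq> 0" if "0 \<le> s" "s \<le> t" "t \<le> 1" for s t
    using that by auto
  define T :: "(real \<times> real) set" where "T = {p. 0 \<le> fst p \<and> fst p \<le> snd p \<and> snd p \<le> 1}"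
  define \<phi> where "\<phi> = (\<lambda>p. \<gamma> (snd p) - \<gamma> (fst p) - k)"
  have "convex T"
  proof (rule convexI)
    fix p q :: "real \<times> real" and u v :: real
    assume *: "p \<in> T" "q \<in> T" "0 \<le> u" "0 \<le> v" "u + v = 1"
    have "u * snd p + v * snd q \<le> u * 1 + v * 1"
      using * by (intro add_mono mult_left_mono) (auto simp: T_def)
    moreover have "u * fst p + v * fst q \<le> u * snd p + v * snd q"
      using * by (intro add_mono mult_left_mono) (auto simp: T_def)
    ultimately show "u *\<^sub>R p + v *\<^sub>R q \<in> T"
      using * by (auto simp: T_def)
  qed
  moreover have "continuous_on T \<phi>"
    unfolding \<phi>_def
    by (intro continuous_intros continuous_on_compose2[OF cont]) (auto simp: T_def)
  moreover have "\<And>p. p \<in> T \<Longrightarrow> \<phi> p \<noteq> 0"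
    using nochord by (auto simp: \<phi>_def T_def)
  ultimately obtain \<theta> where \<theta>: "continuous_on T \<theta>" "\<And>p. p \<in> T \<Longrightarrow> \<phi> p = exp (\<theta> p)"
    using continuous_logarithm_on_contractible[of T \<phi>] convex_imp_contractible by metis
  define m w where "m = (\<gamma> 0 + \<gamma> 1) / 2" and "w = k - (\<gamma> 1 - \<gamma> 0) / 2"
  define h where "h = (\<lambda>t. \<gamma> t - m)"
  have h: "norm w < norm (h t)" if "t \<in> {0..1}" for t
    using far[OF that] by (simp add: h_def m_def w_def)
  have h0: "h t \<noteq> 0" if "t \<in> {0..1}" for t
    using h[OF that] by force
  have hc: "continuous_on {0..1} h" unfolding h_def by (intro continuous_intros cont)
  obtain l where l: "continuous_on {0..1} l" "\<And>t. t \<in> {0..1} \<Longrightarrow> h t = exp (l t)"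
    using continuous_logarithm_on_contractible[OF hc] h0
      convex_imp_contractible[OF convex_real_interval(5)] by metis
  have sm: "norm (w / h t) < 1" if "t \<in> {0..1}" for t
    using h[OF that] h0[OF that] by (simp add: norm_divide)
  have small: "norm (c * w / h t) < 1" if "t \<in> {0..1}" "norm c = 1" for t c
    using sm[OF that(1)] that(2) by (simp add: norm_divide norm_mult)
  have pos: "1 + c * w / h t \<notin> \<real>\<^sub>\<le>\<^sub>0" if "t \<in> {0..1}" "norm c = 1" for t c
  proof -
    have "\<bar>Re (c * w / h t)\<bar> < 1"
      using small[OF that] abs_Re_le_cmod[of "c * w / h t"] by linarith
    thus ?thesis by (auto simp: complex_nonpos_Reals_iff)
  qed
  \<comment> \<open>The factors 1 + w/h and 1 - w/h carry the correction for viewing the path from \<open>m \<mp> w\<close>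
    instead of \<open>m\<close>; they stay in the right half plane, where the principal logarithm is continuous.\<close>
  have cLn: "continuous_on {0..1} (\<lambda>t. Ln (1 + c * w / h t))" if "norm c = 1" for c
    using pos that h0 by (intro continuous_intros hc) auto
  have conn: "connected {0..1::real}" by simp
  have inT: "(0, t) \<in> T" "(t, 1) \<in> T" "(t, t) \<in> T" if "t \<in> {0..1}" for t
    using that by (auto simp: T_def)
  have comp: "continuous_on {0..1} (\<lambda>t. \<theta> (p t))"
    if "continuous_on {0..1} p" "\<And>t. t \<in> {0..1} \<Longrightarrow> p t \<in> T" for p
    using that by (intro continuous_on_compose2[OF \<theta>(1)]) auto
  have diag: "\<theta> (1, 1) - \<theta> (0, 0) = 0"
  proof -
    have "\<theta> (1, 1) - \<theta> (0, 0) = \<theta> (0, 0) - \<theta> (0, 0)"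
    proof (rule log_branches_same_increment[OF conn, where f = "\<lambda>t. \<theta> (t, t)" and g = "\<lambda>_. \<theta> (0, 0)"])
      show "continuous_on {0..1} (\<lambda>t. \<theta> (t, t))"
        using inT by (intro comp continuous_intros) auto
      fix t :: real assume "t \<in> {0..1}"
      thus "exp (\<theta> (t, t)) = exp (\<theta> (0, 0))"
        using \<theta>(2)[of "(t, t)"] \<theta>(2)[of "(0, 0)"] inT[of t] inT[of 0] by (simp add: \<phi>_def)
    qed auto
    thus ?thesis by simp
  qed
  have left: "\<theta> (0, 1) - \<theta> (0, 0) =
      (l 1 + Ln (1 + (-1) * w / h 1)) - (l 0 + Ln (1 + (-1) * w / h 0))"
  proof (rule log_branches_same_increment[OF conn, where f = "\<lambda>t. \<theta> (0, t)"
        and g = "\<lambda>t. l t + Ln (1 + (-1) * w / h t)"])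
    show "continuous_on {0..1} (\<lambda>t. \<theta> (0, t))"
      using inT by (intro comp continuous_intros) auto
    show "continuous_on {0..1} (\<lambda>t. l t + Ln (1 + (-1) * w / h t))"
      by (intro continuous_on_add l cLn) auto
    fix t :: real assume t: "t \<in> {0..1}"
    have "1 + (-1) * w / h t \<noteq> 0" using pos[OF t, of "-1"] by force
    hence "exp (l t + Ln (1 + (-1) * w / h t)) = h t * (1 + (-1) * w / h t)"
      using l(2)[OF t] by (simp add: exp_add)
    also have "\<dots> = h t - w" using h0[OF t] by (simp add: field_simps)
    also have "\<dots> = \<phi> (0, t)" by (simp add: h_def w_def m_def \<phi>_def field_simps)
    finally show "exp (\<theta> (0, t)) = exp (l t + Ln (1 + (-1) * w / h t))"
      using \<theta>(2)[of "(0, t)"] inT[OF t] by simp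
  qed auto
  \<comment> \<open>The summand \<open>\<i> * pi\<close> accounts for the sign in \<open>\<phi> (t, 1) = - (h t + w)\<close>.\<close>
  have top: "\<theta> (1, 1) - \<theta> (0, 1) =
      (l 1 + \<i> * pi + Ln (1 + 1 * w / h 1)) - (l 0 + \<i> * pi + Ln (1 + 1 * w / h 0))"
  proof (rule log_branches_same_increment[OF conn, where f = "\<lambda>t. \<theta> (t, 1)"
        and g = "\<lambda>t. l t + \<i> * pi + Ln (1 + 1 * w / h t)"])
    show "continuous_on {0..1} (\<lambda>t. \<theta> (t, 1))"
      using inT by (intro comp continuous_intros) auto
    show "continuous_on {0..1} (\<lambda>t. l t + \<i> * pi + Ln (1 + 1 * w / h t))"
      by (intro continuous_on_add l cLn continuous_intros) auto
    fix t :: real assume t: "t \<in> {0..1}"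
    have "1 + 1 * w / h t \<noteq> 0" using pos[OF t, of "1"] by force
    hence "exp (l t + \<i> * pi + Ln (1 + 1 * w / h t)) = - h t * (1 + 1 * w / h t)"
      using l(2)[OF t] by (simp add: exp_add)
    also have "\<dots> = - h t - w" using h0[OF t] by (simp add: field_simps)
    also have "\<dots> = \<phi> (t, 1)" by (simp add: h_def w_def m_def \<phi>_def field_simps)
    finally show "exp (\<theta> (t, 1)) = exp (l t + \<i> * pi + Ln (1 + 1 * w / h t))"
      using \<theta>(2)[of "(t, 1)"] inT[OF t] by simp
  qed auto
  \<comment> \<open>This is where \<open>m\<close> being the midpoint makes the corrections in \<open>left\<close> and \<open>top\<close> cancel.\<close>
  have opp: "h 0 = - h 1" by (simp add: h_def m_def field_simps)
  have "\<theta> (1, 1) - \<theta> (0, 0) = (\<theta> (1, 1) - \<theta> (0, 1)) + (\<theta> (0, 1) - \<theta> (0, 0))"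
    by simp
  also have "\<dots> = 2 * (l 1 - l 0)"
    unfolding left top opp by (simp add: algebra_simps)
  finally have "l 1 = l 0" using diag by simp
  hence "h 1 = h 0" using l(2)[of 0] l(2)[of 1] by simp
  thus False using opp h0[of 1] by simp
qed

section \<open>Convex hulls of sets that nearly contain their midpoints\<close>

text \<open>Bisection: on the half of the segment that contains the point, the midpoint is replaced by a
  nearby element of \<open>X\<close>. This costs \<open>r\<close> and lengthens the halved segment by at most \<open>r\<close>, so
  \<open>m\<close> bisections leave an error of \<open>2 r m\<close> plus the remaining length.\<close>
lemma midpoint_approx_imp_segment_approx:
  fixes X :: "'a::real_normed_vector set" and m :: nat and r t :: real
  assumes mid: "\<And>a b. a \<in> X \<Longrightarrow> b \<in> X \<Longrightarrow> \<exists>c\<in>X. dist c (midpoint a b) \<le> r"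
    and r: "0 \<le> r" and ab: "a \<in> X" "b \<in> X" and t: "0 \<le> t" "t \<le> 1"
  shows "\<exists>c\<in>X. dist c ((1 - t) *\<^sub>R a + t *\<^sub>R b) \<le> 2 * r * m + dist a b / 2 ^ m"
  using ab t
proof (induction m arbitrary: a b t)
  case 0
  have "a - ((1 - t) *\<^sub>R a + t *\<^sub>R b) = t *\<^sub>R (a - b)" by (simp add: algebra_simps)
  hence "dist a ((1 - t) *\<^sub>R a + t *\<^sub>R b) = t * dist a b"
    using 0 by (simp add: dist_norm)
  also have "\<dots> \<le> 1 * dist a b" using 0 by (intro mult_right_mono) auto
  finally show ?case using 0 by auto
next
  case (Suc m)
  have half: "\<exists>c\<in>X. dist c ((1 - t) *\<^sub>R a + t *\<^sub>R b) \<le> 2 * r * Suc m + dist a b / 2 ^ Suc m"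
    if ab: "a \<in> X" "b \<in> X" and t: "0 \<le> t" "t \<le> 1/2" for a b t
  proof -
    obtain c where c: "c \<in> X" "dist c (midpoint a b) \<le> r" using mid ab by blast
    obtain x where x: "x \<in> X"
      "dist x ((1 - 2 * t) *\<^sub>R a + (2 * t) *\<^sub>R c) \<le> 2 * r * m + dist a c / 2 ^ m"
      using Suc.IH[of a c "2 * t"] ab c t by auto
    have "dist a c \<le> dist a (midpoint a b) + dist c (midpoint a b)"
      by (metis dist_commute dist_triangle)
    hence "dist a c \<le> dist a b / 2 + r" using c by (simp add: dist_midpoint)
    hence "dist a c / 2 ^ m \<le> (dist a b / 2 + r) / 2 ^ m" by (intro divide_right_mono) auto
    moreover have "r / 2 ^ m \<le> r" using r by (simp add: divide_le_eq mult_le_cancel_left1)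
    ultimately have 1: "dist a c / 2 ^ m \<le> dist a b / 2 ^ Suc m + r"
      by (simp add: add_divide_distrib)
    have "(1 - 2 * t) *\<^sub>R a + (2 * t) *\<^sub>R c - ((1 - t) *\<^sub>R a + t *\<^sub>R b)
        = (2 * t) *\<^sub>R (c - midpoint a b)"
      by (simp add: algebra_simps midpoint_def flip: scaleR_add_left)
    hence "dist ((1 - 2 * t) *\<^sub>R a + (2 * t) *\<^sub>R c) ((1 - t) *\<^sub>R a + t *\<^sub>R b)
        = 2 * t * dist c (midpoint a b)"
      using t by (simp add: dist_norm)
    also have "\<dots> \<le> 1 * r" using c t by (intro mult_mono) auto
    finally have "dist x ((1 - t) *\<^sub>R a + t *\<^sub>R b) \<le> 2 * r * m + dist a c / 2 ^ m + r"
      using x(2) dist_triangle[of x "(1 - t) *\<^sub>R a + t *\<^sub>R b" "(1 - 2 * t) *\<^sub>R a + (2 * t) *\<^sub>R c"]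
      by linarith
    thus ?thesis using 1 x(1) by (intro bexI[of _ x]) (auto simp: algebra_simps)
  qed
  show ?case
  proof (cases "t \<le> 1/2")
    case True
    thus ?thesis using half Suc.prems by blast
  next
    case False
    thus ?thesis using half[of b a "1 - t"] Suc.prems
      by (simp add: add.commute dist_commute)
  qed
qed

text \<open>Adding a vertex \<open>s\<close> replaces \<open>p\<close> by a point on a segment from \<open>s\<close> to a point of the smaller
  hull; that point is moved into \<open>X\<close> and the segment estimate is used once more.\<close>
lemma midpoint_approx_imp_finite_hull_approx:
  fixes X :: "'a::real_normed_vector set" and m :: nat and r d :: real
  assumes mid: "\<And>a b. a \<in> X \<Longrightarrow> b \<in> X \<Longrightarrow> \<exists>c\<in>X. dist c (midpoint a b) \<le> r"
    and r: "0 \<le> r" and d: "\<And>a b. a \<in> X \<Longrightarrow> b \<in> X \<Longrightarrow> dist a b \<le> d"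
    and S: "finite S" "S \<subseteq> X" and p: "p \<in> convex hull S"
  shows "\<exists>c\<in>X. dist c p \<le> card S * (2 * r * m + d / 2 ^ m)"
  using S p
proof (induction S arbitrary: p rule: finite_induct)
  case empty
  thus ?case by simp
next
  case (insert s S)
  have "0 \<le> d" using d[of s s] insert by auto
  hence nn: "0 \<le> 2 * r * m + d / 2 ^ m" using r by auto
  show ?case
  proof (cases "S = {}")
    case True
    thus ?thesis using insert.prems nn by (intro bexI[of _ s]) auto
  next
    case False
    then obtain u v b where *: "0 \<le> u" "0 \<le> v" "u + v = 1" "b \<in> convex hull S"
      "p = u *\<^sub>R s + v *\<^sub>R b"
      using insert.prems(2) by (auto simp: convex_hull_insert)
    obtain c where c: "c \<in> X" "dist c b \<le> card S * (2 * r * m + d / 2 ^ m)"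
      using insert.IH[OF _ *(4)] insert.prems by auto
    have u: "u = 1 - v" using * by simp
    obtain x where x: "x \<in> X" "dist x (u *\<^sub>R s + v *\<^sub>R c) \<le> 2 * r * m + dist s c / 2 ^ m"
      using midpoint_approx_imp_segment_approx[OF mid r, of s c v m] insert.prems c * unfolding u by auto
    have "dist s c / 2 ^ m \<le> d / 2 ^ m"
      using d[of s c] insert.prems c by (intro divide_right_mono) auto
    moreover have "dist (u *\<^sub>R s + v *\<^sub>R c) p = v * dist c b"
      using * by (simp add: dist_norm flip: scaleR_diff_right)
    moreover have "v * dist c b \<le> 1 * dist c b" using * by (intro mult_right_mono) auto
    ultimately have "dist x p \<le> (1 + card S) * (2 * r * m + d / 2 ^ m)"
      using x(2) c(2) dist_triangle[of x p "u *\<^sub>R s + v *\<^sub>R c"] by (simp add: algebra_simps add_divide_distrib)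
    thus ?thesis using x(1) insert.hyps by auto
  qed
qed

text \<open>By Caratheodory's theorem \<open>DIM('a) + 1\<close> vertices suffice, so the error is uniform over the
  whole hull. For fixed \<open>m\<close> it is a constant plus a small fraction of the diameter \<open>d\<close>, which
  is what is needed for sets whose diameter grows while \<open>r\<close> stays fixed.\<close>
lemma midpoint_approx_imp_hull_approx:
  fixes X :: "'a::euclidean_space set" and m :: nat and r d :: real
  assumes mid: "\<And>a b. a \<in> X \<Longrightarrow> b \<in> X \<Longrightarrow> \<exists>c\<in>X. dist c (midpoint a b) \<le> r"
    and r: "0 \<le> r" and d: "\<And>a b. a \<in> X \<Longrightarrow> b \<in> X \<Longrightarrow> dist a b \<le> d"
    and p: "p \<in> convex hull X"
  shows "\<exists>c\<in>X. dist c p \<le> (DIM('a) + 1) * (2 * r * m + d / 2 ^ m)"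
proof -
  obtain S where S: "finite S" "S \<subseteq> X" "card S \<le> DIM('a) + 1" "p \<in> convex hull S"
    using p unfolding caratheodory[of X] by auto
  obtain c where c: "c \<in> X" "dist c p \<le> card S * (2 * r * m + d / 2 ^ m)"
    using midpoint_approx_imp_finite_hull_approx[OF mid r d S(1,2,4)] by blast
  have "0 \<le> d" using d[OF c(1) c(1)] by simp
  hence "card S * (2 * r * m + d / 2 ^ m) \<le> (DIM('a) + 1) * (2 * r * m + d / 2 ^ m)"
    using S(3) r by (intro mult_right_mono) auto
  with c show ?thesis by (meson order_trans)
qed

section \<open>The fundamental square and lifts of torus homeomorphisms\<close>

text \<open>The fundamental domain is taken half-open, so that no two of its points differ by a nonzero
  lattice vector, while it is still convex and its translates cover the plane.\<close>
definition half_open_square :: "(real^2) set" where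
  "half_open_square = {x. \<forall>i. 0 \<le> x $ i \<and> x $ i < 1}"

lemma half_open_square_subset: "half_open_square \<subseteq> unit_square"
  by (auto simp: half_open_square_def unit_square_def mem_box_cart less_imp_le)

lemma zero_in_half_open_square: "0 \<in> half_open_square"
  by (simp add: half_open_square_def)

lemma norm_unit_square: "x \<in> unit_square \<Longrightarrow> norm x \<le> 2"
  using norm_le_l1_cart[of x] by (auto simp: unit_square_def mem_box_cart sum_2 forall_2)

lemma convex_half_open_square: "convex half_open_square"
proof -
  have eq: "half_open_square = (\<Inter>i. {x. x $ i \<ge> 0} \<inter> {x. x $ i < 1})"
    by (auto simp: half_open_square_def)
  have "convex {x :: real^2. x $ i \<ge> 0}" "convex {x :: real^2. x $ i < 1}" for i
    using convex_halfspace_ge[of 0 "axis i (1::real)"] convex_halfspace_lt[of "axis i (1::real)" 1]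
    by (simp_all add: inner_axis inner_commute)
  thus ?thesis unfolding eq by (intro convex_INT convex_Int) auto
qed

lemma lattice_decomposition:
  obtains d k where "d \<in> half_open_square" "k \<in> int_lattice" "x = d + k"
proof
  show "(\<chi> i. frac (x $ i)) \<in> half_open_square"
    by (simp add: half_open_square_def frac_lt_1)
  show "(\<chi> i. of_int \<lfloor>x $ i\<rfloor>) \<in> int_lattice"
    by (simp add: int_lattice_def)
  show "x = (\<chi> i. frac (x $ i)) + (\<chi> i. of_int \<lfloor>x $ i\<rfloor>)"
    by (simp add: vec_eq_iff frac_def)
qed

lemma nearby_lattice_point:
  obtains k where "k \<in> int_lattice" "norm (k - v) \<le> 1"
proof
  let ?k = "(\<chi> i. of_int (round (v $ i))) :: real^2"
  show "?k \<in> int_lattice" by (simp add: int_lattice_def)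
  have "norm (?k - v) \<le> \<bar>(?k - v) $ 1\<bar> + \<bar>(?k - v) $ 2\<bar>"
    using norm_le_l1_cart[of "?k - v"] by (simp add: sum_2)
  also have "\<dots> \<le> 1/2 + 1/2"
    using of_int_round_abs_le[of "v $ 1"] of_int_round_abs_le[of "v $ 2"]
    by (intro add_mono) auto
  finally show "norm (?k - v) \<le> 1" by simp
qed

lemma torus_liftsD:
  assumes "F \<in> torus_lifts"
  shows "continuous_on UNIV F" "inj F" "\<And>x k. k \<in> int_lattice \<Longrightarrow> F (x + k) = F x + k"
proof -
  obtain G where G: "homeomorphism UNIV UNIV F G" using assms by (auto simp: torus_lifts_def)
  show "continuous_on UNIV F" by (rule homeomorphism_cont1[OF G])
  show "inj F" by (rule inj_on_inverseI[of _ G]) (simp add: homeomorphism_apply1[OF G])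
  show "\<And>x k. k \<in> int_lattice \<Longrightarrow> F (x + k) = F x + k"
    using assms by (auto simp: torus_lifts_def)
qed

lemma funpow_torus_lifts:
  assumes F: "F \<in> torus_lifts"
  shows "F ^^ n \<in> torus_lifts"
proof (induction n)
  case 0
  have "homeomorphism UNIV UNIV (\<lambda>x :: real^2. x) (\<lambda>x. x)"
    by (auto simp: homeomorphism_def)
  thus ?case by (auto simp: torus_lifts_def)
next
  case (Suc n)
  obtain G H where "homeomorphism UNIV UNIV F G" "homeomorphism UNIV UNIV (F ^^ n) H"
    using F Suc by (auto simp: torus_lifts_def)
  hence "homeomorphism UNIV UNIV (F ^^ Suc n) (H \<circ> G)"
    using homeomorphism_compose by force
  moreover have "(F ^^ Suc n) (x + k) = (F ^^ Suc n) x + k" if "k \<in> int_lattice" for x k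
    using that torus_liftsD(3)[OF F] torus_liftsD(3)[OF Suc] by simp
  ultimately show ?case unfolding torus_lifts_def by blast
qed

lemma displacement_bounded:
  assumes F: "F \<in> torus_lifts"
  obtains M where "0 \<le> M" "\<And>x. dist (F x) x \<le> M"
proof -
  have "compact ((\<lambda>x. F x - x) ` unit_square)"
    unfolding unit_square_def
    by (intro compact_continuous_image compact_cbox continuous_intros
        continuous_on_subset[OF torus_liftsD(1)[OF F]]) auto
  then obtain M where M: "\<And>x. x \<in> unit_square \<Longrightarrow> norm (F x - x) \<le> M"
    using compact_imp_bounded[of "(\<lambda>x. F x - x) ` unit_square"] by (auto simp: bounded_iff)
  have "dist (F x) x \<le> M" for x
  proof -
    obtain d k where dk: "d \<in> half_open_square" "k \<in> int_lattice" "x = d + k"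
      by (rule lattice_decomposition)
    have "F x - x = F d - d" using torus_liftsD(3)[OF F dk(2)] dk by simp
    thus ?thesis using M[of d] half_open_square_subset dk(1) by (metis dist_norm subsetD)
  qed
  thus ?thesis using that zero_le_dist order_trans by blast
qed

lemma funpow_displacement_le:
  assumes "\<And>x. dist (F x) x \<le> (M::real)"
  shows "dist ((F ^^ n) x) x \<le> n * M"
proof (induction n)
  case (Suc n)
  have "dist ((F ^^ Suc n) x) x \<le> dist (F ((F ^^ n) x)) ((F ^^ n) x) + dist ((F ^^ n) x) x"
    by (simp add: dist_triangle)
  also have "\<dots> \<le> M + n * M" using Suc assms by (intro add_mono) auto
  finally show ?case by (simp add: algebra_simps)
qed auto

lemma iterated_square_norm_le:
  assumes M: "\<And>x. dist (F x) x \<le> M" and c: "c \<in> (F ^^ N) ` half_open_square"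
  shows "norm c \<le> real N * M + 2"
proof -
  obtain x where x: "x \<in> half_open_square" "c = (F ^^ N) x" using c by auto
  have "norm c \<le> dist c x + norm x" by (metis dist_0_norm dist_commute dist_triangle)
  thus ?thesis using funpow_displacement_le[of F M N x] M x half_open_square_subset
      norm_unit_square[of x] by force
qed

section \<open>Images of the square are almost convex\<close>

definition plane_complex :: "real^2 \<Rightarrow> complex" where
  "plane_complex v = Complex (v $ 1) (v $ 2)"

lemma linear_plane_complex: "linear plane_complex"
  by (rule linearI) (auto simp: plane_complex_def complex_eq_iff)

lemma norm_plane_complex [simp]: "norm (plane_complex v) = norm v"
  by (simp add: plane_complex_def norm_vec_def L2_set_def cmod_def sum_2)

text \<open>Join \<open>a\<close> and \<open>b\<close> by the image of a segment, and let \<open>k\<close> be a lattice vector within distance 1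
  of \<open>(b - a)/2\<close>. If the image missed the unit disc around the midpoint, \<open>k\<close> would be a
  chord of the path. A chord in the lattice says that two points of the square differ by \<open>k\<close>,
  because \<open>G\<close> is injective and commutes with the translation by \<open>k\<close>; hence \<open>k = 0\<close>, and then
  \<open>a\<close> itself is within distance 1 of the midpoint.\<close>
lemma midpoint_near_image:
  assumes G: "G \<in> torus_lifts" and ab: "a \<in> G ` half_open_square" "b \<in> G ` half_open_square"
  shows "\<exists>c\<in>G ` half_open_square. dist c (midpoint a b) \<le> 1"
proof (rule ccontr)
  assume neg: "\<not> ?thesis"
  obtain x y where xy: "x \<in> half_open_square" "a = G x" "y \<in> half_open_square" "b = G y"
    using ab by auto
  obtain k where k: "k \<in> int_lattice" "norm (k - (1/2) *\<^sub>R (b - a)) \<le> 1"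
    by (rule nearby_lattice_point)
  define l where "l = linepath x y"
  have l: "l t \<in> half_open_square" if "t \<in> {0..1}" for t
    using convex_half_open_square xy that closed_segment_subset[of x half_open_square y]
    unfolding l_def by (auto simp: linepath_in_path)
  have lin: "plane_complex (u + v) = plane_complex u + plane_complex v"
    "plane_complex (u - v) = plane_complex u - plane_complex v"
    "plane_complex (r *\<^sub>R u) = r *\<^sub>R plane_complex u" for u v r
    using linear_plane_complex by (simp_all add: linear_add linear_diff linear_scale)
  let ?\<gamma> = "\<lambda>t. plane_complex (G (l t))"
  have "\<exists>s t. 0 \<le> s \<and> s \<le> t \<and> t \<le> 1 \<and> ?\<gamma> t - ?\<gamma> s = plane_complex k"
  proof (rule path_avoiding_midpoint_has_chord)
    show "continuous_on {0..1} ?\<gamma>"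
      unfolding l_def
      by (intro continuous_on_compose2[OF linear_continuous_on[OF linear_conv_bounded_linear[THEN iffD1, OF linear_plane_complex], of UNIV]]
          continuous_on_compose2[OF torus_liftsD(1)[OF G]] continuous_on_linepath) auto
    fix t :: real assume t: "t \<in> {0..1}"
    have "plane_complex k - (?\<gamma> 1 - ?\<gamma> 0) / 2 = plane_complex (k - (1/2) *\<^sub>R (b - a))"
      unfolding lin by (simp add: l_def linepath_0' linepath_1' xy scaleR_conv_of_real)
    moreover have "?\<gamma> t - (?\<gamma> 0 + ?\<gamma> 1) / 2 = plane_complex (G (l t) - midpoint a b)"
      unfolding midpoint_def lin by (simp add: l_def linepath_0' linepath_1' xy scaleR_conv_of_real)
    moreover have "1 < norm (G (l t) - midpoint a b)"
      using neg l[OF t] by (auto simp: dist_norm not_le)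
    ultimately show "norm (plane_complex k - (?\<gamma> 1 - ?\<gamma> 0) / 2)
        < norm (?\<gamma> t - (?\<gamma> 0 + ?\<gamma> 1) / 2)"
      using k by simp
  qed
  then obtain s t where st: "0 \<le> s" "s \<le> t" "t \<le> 1" "?\<gamma> t - ?\<gamma> s = plane_complex k"
    by blast
  have "plane_complex (G (l t) - (G (l s) + k)) = 0"
    using st(4) by (simp add: lin flip: diff_diff_eq)
  hence "G (l t) = G (l s) + k"
    by (metis norm_plane_complex norm_eq_zero right_minus_eq)
  hence "G (l t) = G (l s + k)" using torus_liftsD(3)[OF G k(1)] by simp
  hence *: "l t = l s + k" using torus_liftsD(2)[OF G] by (auto dest: injD)
  have "k $ i = 0" for i
  proof -
    have "0 \<le> l t $ i" "l t $ i < 1" "0 \<le> l s $ i" "l s $ i < 1"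
      using l[of s] l[of t] st by (auto simp: half_open_square_def)
    moreover obtain j :: int where j: "k $ i = j" using k by (auto simp: int_lattice_def elim: Ints_cases)
    ultimately have "-1 < real_of_int j" "real_of_int j < 1"
      using arg_cong[OF *, of "\<lambda>v. v $ i"] by auto
    thus ?thesis using j by auto
  qed
  hence "k = 0" by (simp add: vec_eq_iff)
  hence "dist a (midpoint a b) \<le> 1"
    unfolding dist_midpoint using k by (simp add: dist_norm norm_minus_commute)
  thus False using neg ab by auto
qed

text \<open>The midpoint estimate has the same error 1 for every iterate, whereas the diameter of the
  \<open>n\<close>-th image grows at most linearly in \<open>n\<close>. So the image, rescaled by \<open>1/n\<close>, becomes
  convex in the limit.\<close>
lemma iterated_square_almost_convex:
  assumes F: "F \<in> torus_lifts" and \<delta>: "0 < \<delta>"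
  shows "\<exists>n0. \<forall>n\<ge>n0. \<forall>p \<in> convex hull ((F ^^ n) ` half_open_square).
           \<exists>c\<in>(F ^^ n) ` half_open_square. dist c p \<le> \<delta> * real n"
proof -
  obtain M where M: "0 \<le> M" "\<And>x. dist (F x) x \<le> M" by (rule displacement_bounded[OF F]) auto
  \<comment> \<open>Enough bisections to make the remaining length a fraction of \<open>\<delta> n\<close>, then \<open>n\<close> large
    enough to absorb the accumulated error; the factor 3 in both is \<open>DIM(real^2) + 1\<close>.\<close>
  obtain m :: nat where m: "(2 * M + 4) * 6 / \<delta> < 2 ^ m"
    using real_arch_pow[of 2] by auto
  obtain n0 :: nat where n0: "12 * real m / \<delta> < n0" using reals_Archimedean2 by blast
  show ?thesis
  proof (intro exI allI impI ballI)
    fix n p assume n: "max n0 1 \<le> n" and p: "p \<in> convex hull ((F ^^ n) ` half_open_square)"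
    let ?A = "(F ^^ n) ` half_open_square"
    let ?d = "2 * (n * M) + 4"
    have "\<exists>c\<in>?A. dist c p \<le> (DIM(real^2) + 1) * (2 * (1::real) * real m + ?d / 2 ^ m)"
    proof (rule midpoint_approx_imp_hull_approx[OF _ _ _ p])
      fix a b assume "a \<in> ?A" "b \<in> ?A"
      thus "\<exists>c\<in>?A. dist c (midpoint a b) \<le> 1"
        by (rule midpoint_near_image[OF funpow_torus_lifts[OF F]])
      have "norm z \<le> n * M + 2" if "z \<in> ?A" for z
        by (rule iterated_square_norm_le[OF M(2) that])
      from this[OF \<open>a \<in> ?A\<close>] this[OF \<open>b \<in> ?A\<close>] show "dist a b \<le> ?d"
        using norm_triangle_ineq4[of a b] by (simp add: dist_norm)
    qed simp
    then obtain c where c: "c \<in> ?A" "dist c p \<le> 6 * m + 3 * (?d / 2 ^ m)"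
      by (auto simp: algebra_simps)
    have "12 * real m \<le> \<delta> * n0" using n0 \<delta> by (simp add: field_simps)
    also have "\<dots> \<le> \<delta> * n" using n \<delta> by (intro mult_left_mono) auto
    finally have 1: "12 * real m \<le> \<delta> * n" .
    have "?d \<le> n * (2 * M + 4)" using n by (simp add: algebra_simps)
    also have "\<dots> \<le> n * (\<delta> * 2 ^ m / 6)"
      using m \<delta> by (intro mult_left_mono) (auto simp: field_simps)
    finally have "?d / 2 ^ m \<le> \<delta> * n / 6" by (simp add: field_simps)
    hence "3 * (?d / 2 ^ m) \<le> \<delta> * n / 2" by linarith
    with 1 c(2) have "dist c p \<le> \<delta> * real n" by linarith
    with c(1) show "\<exists>c\<in>?A. dist c p \<le> \<delta> * real n" by blast
  qed
qed

section \<open>Mean speeds of pseudo-orbits\<close>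

definition pseudo_orbit :: "('a::metric_space \<Rightarrow> 'a) \<Rightarrow> real \<Rightarrow> (nat \<Rightarrow> 'a) \<Rightarrow> nat \<Rightarrow> bool" where
  "pseudo_orbit F e y n \<longleftrightarrow> (\<forall>k<n. dist (F (y k)) (y (Suc k)) \<le> e)"

lemma pseudo_orbit_shift:
  "pseudo_orbit F e y n \<Longrightarrow> j + m \<le> n \<Longrightarrow> pseudo_orbit F e (\<lambda>i. y (j + i)) m"
  by (simp add: pseudo_orbit_def)

lemma orbit_is_pseudo_orbit: "0 \<le> e \<Longrightarrow> pseudo_orbit F e (\<lambda>k. (F ^^ k) x) n"
  by (simp add: pseudo_orbit_def)

text \<open>At each step the error made so far is multiplied by at most \<open>L\<close>. The exponential bound is
  harmless because it is used only for pseudo-orbits of a fixed length.\<close>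
lemma pseudo_orbit_shadowed:
  assumes "pseudo_orbit F e y n" "L-lipschitz_on UNIV F" "1 \<le> L" "0 \<le> e"
  shows "dist (y n) ((F ^^ n) (y 0)) \<le> real n * L ^ n * e"
  using assms(1)
proof (induction n)
  case (Suc n)
  have IH: "dist (y n) ((F ^^ n) (y 0)) \<le> real n * L ^ n * e"
    using Suc by (simp add: pseudo_orbit_def)
  have "dist (F (y n)) (F ((F ^^ n) (y 0))) \<le> L * dist (y n) ((F ^^ n) (y 0))"
    using assms(2) by (rule lipschitz_onD) auto
  also have "\<dots> \<le> L * (real n * L ^ n * e)" using IH assms by (intro mult_left_mono) auto
  finally have "dist (y (Suc n)) ((F ^^ Suc n) (y 0)) \<le> e + L * (real n * L ^ n * e)"
    using Suc.prems dist_triangle[of "y (Suc n)" "(F ^^ Suc n) (y 0)" "F (y n)"]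
    by (auto simp: pseudo_orbit_def dist_commute)
  moreover have "1 * e \<le> L ^ Suc n * e"
    using assms by (intro mult_right_mono one_le_power) auto
  ultimately show ?case by (simp add: algebra_simps)
qed simp

lemma pseudo_orbit_displacement_le:
  assumes "pseudo_orbit F e y n" "\<And>x. dist (F x) x \<le> M"
  shows "dist (y n) (y 0) \<le> real n * (M + e)"
  using assms(1)
proof (induction n)
  case (Suc n)
  have "dist (y (Suc n)) (y 0) \<le> dist (F (y n)) (y (Suc n)) + dist (F (y n)) (y n) + dist (y n) (y 0)"
    by metric
  also have "\<dots> \<le> e + M + real n * (M + e)"
    using Suc assms(2) by (intro add_mono) (auto simp: pseudo_orbit_def)
  finally show ?case by (simp add: algebra_simps)
qed simp

text \<open>By lattice equivariance the block may be taken to start in the fundamental square. The error 3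
  is 1 for the shadowing and 2 for the size of the square.\<close>
lemma block_displacement:
  assumes F: "F \<in> torus_lifts" and L: "L-lipschitz_on UNIV F" "1 \<le> L"
    and y: "pseudo_orbit F e y N" and e: "0 \<le> e" "real N * L ^ N * e \<le> 1"
  shows "\<exists>a\<in>(F ^^ N) ` half_open_square. dist (y N - y 0) a \<le> 3"
proof -
  obtain d k where dk: "d \<in> half_open_square" "k \<in> int_lattice" "y 0 = d + k"
    by (rule lattice_decomposition)
  have eq: "(F ^^ N) (y 0) = (F ^^ N) d + k"
    unfolding dk(3) by (rule torus_liftsD(3)[OF funpow_torus_lifts[OF F] dk(2)])
  have "y N - y 0 - (F ^^ N) d = (y N - (F ^^ N) (y 0)) + (- d)"
    unfolding eq unfolding dk(3) by simp
  hence "dist (y N - y 0) ((F ^^ N) d) \<le> dist (y N) ((F ^^ N) (y 0)) + norm d"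
    by (metis dist_norm norm_triangle_ineq norm_minus_cancel)
  also have "\<dots> \<le> 1 + 2"
    using pseudo_orbit_shadowed[OF y L e(1)] e(2) dk half_open_square_subset norm_unit_square
    by (intro add_mono) force+
  finally show ?thesis using dk by auto
qed

text \<open>The mean displacement of \<open>q\<close> consecutive blocks is the average of \<open>q\<close> points near the image
  of the square. This is how the convex hull comes in, and the error per block does not depend
  on the number of blocks.\<close>
lemma blocks_displacement:
  assumes F: "F \<in> torus_lifts" and L: "L-lipschitz_on UNIV F" "1 \<le> L"
    and y: "pseudo_orbit F e y (q * N)" and e: "0 \<le> e" "real N * L ^ N * e \<le> 1"
  shows "\<exists>p\<in>convex hull ((F ^^ N) ` half_open_square).
           dist (y (q * N) - y 0) (real q *\<^sub>R p) \<le> 3 * real q"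
  using y
proof (induction q)
  case 0
  have "(F ^^ N) 0 \<in> convex hull ((F ^^ N) ` half_open_square)"
    using zero_in_half_open_square by (intro hull_inc) auto
  thus ?case by auto
next
  case (Suc q)
  let ?H = "convex hull ((F ^^ N) ` half_open_square)"
  obtain p where p: "p \<in> ?H" "dist (y (q * N) - y 0) (real q *\<^sub>R p) \<le> 3 * real q"
    using Suc pseudo_orbit_shift[of F e y "Suc q * N" 0 "q * N"] by auto
  have "pseudo_orbit F e (\<lambda>i. y (q * N + i)) N"
    using Suc.prems by (rule pseudo_orbit_shift) simp
  from block_displacement[OF F L this e]
  obtain a where a: "a \<in> (F ^^ N) ` half_open_square" "dist (y (q * N + N) - y (q * N)) a \<le> 3"
    by auto
  define p' where "p' = (real q / (real q + 1)) *\<^sub>R p + (1 / (real q + 1)) *\<^sub>R a"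
  have p': "p' \<in> ?H"
    unfolding p'_def using p a
    by (intro convexD[OF convex_convex_hull]) (auto simp: hull_inc add_divide_distrib[symmetric])
  have eq: "real (Suc q) *\<^sub>R p' = real q *\<^sub>R p + a"
    by (simp add: p'_def scaleR_add_right add.commute)
  have "dist (y (Suc q * N) - y 0) (real (Suc q) *\<^sub>R p')
      = norm ((y (q * N) - y 0 - real q *\<^sub>R p) + (y (q * N + N) - y (q * N) - a))"
    unfolding eq dist_norm by (simp add: algebra_simps)
  also have "\<dots> \<le> 3 * real q + 3"
    using p(2) a(2) by (intro norm_triangle_mono) (simp_all add: dist_norm)
  finally show ?case using p' by (intro bexI[of _ p']) auto
qed

text \<open>Cut a long pseudo-orbit into blocks of length \<open>N\<close>. Its mean speed is then, up to \<open>3/N\<close> and an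
  incomplete last block, an average of elements of \<open>F\<^sup>N(D)/N\<close> for the fundamental square
  \<open>D\<close>, and that set is almost convex for large \<open>N\<close>. The jump size \<open>e\<close> depends on \<open>N\<close> only,
  not on the length of the pseudo-orbit.\<close>
lemma pseudo_orbit_speed:
  assumes F: "F \<in> torus_lifts" and L: "L-lipschitz_on UNIV F" "1 \<le> L" and \<delta>: "0 < \<delta>"
  shows "\<exists>N0. \<forall>N\<ge>N0. \<exists>e>0. \<exists>n1. \<forall>y n. n1 \<le> n \<and> pseudo_orbit F e y n \<longrightarrow>
           (\<exists>c\<in>(F ^^ N) ` half_open_square. dist ((y n - y 0) /\<^sub>R real n) (c /\<^sub>R real N) \<le> \<delta>)"
proof -
  obtain M where M: "0 \<le> M" "\<And>x. dist (F x) x \<le> M" by (rule displacement_bounded[OF F]) auto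
  obtain n0 where n0: "\<And>n p. n0 \<le> n \<Longrightarrow> p \<in> convex hull ((F ^^ n) ` half_open_square) \<Longrightarrow>
      \<exists>c\<in>(F ^^ n) ` half_open_square. dist c p \<le> \<delta> / 3 * real n"
    using iterated_square_almost_convex[OF F, of "\<delta> / 3"] \<delta> by auto
  obtain n2 :: nat where n2: "9 / \<delta> < n2" using reals_Archimedean2 by blast
  show ?thesis
  proof (intro exI[of _ "max 1 (max n0 n2)"] allI impI)
    fix N assume N: "max 1 (max n0 n2) \<le> N"
    define e where "e = 1 / (real N * L ^ N)"
    have NL: "1 \<le> real N * L ^ N"
      using N L mult_mono[of 1 "real N" 1 "L ^ N"] by (simp add: one_le_power)
    hence e: "0 < e" "e \<le> 1" "real N * L ^ N * e \<le> 1" by (auto simp: e_def divide_le_eq)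
    obtain n1 :: nat where n1: "3 * (real N * (2 * M + 1) + 2) / \<delta> < n1"
      using reals_Archimedean2 by blast
    show "\<exists>e>0. \<exists>n1. \<forall>y n. n1 \<le> n \<and> pseudo_orbit F e y n \<longrightarrow>
        (\<exists>c\<in>(F ^^ N) ` half_open_square. dist ((y n - y 0) /\<^sub>R real n) (c /\<^sub>R real N) \<le> \<delta>)"
    proof (intro exI[of _ e] conjI e(1) exI[of _ "max 1 n1"] allI impI)
      fix y n assume "max 1 n1 \<le> n \<and> pseudo_orbit F e y n"
      hence n: "1 \<le> n" "n1 \<le> n" and y: "pseudo_orbit F e y n" by auto
      define q r where "q = n div N" and "r = n mod N"
      have nqr: "n = q * N + r" by (simp add: q_def r_def)
      have rN: "r \<le> N" using N by (simp add: r_def less_imp_le)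
      obtain p where p: "p \<in> convex hull ((F ^^ N) ` half_open_square)"
        "dist (y (q * N) - y 0) (real q *\<^sub>R p) \<le> 3 * real q"
        using blocks_displacement[OF F L _ less_imp_le[OF e(1)] e(3), of y q]
          pseudo_orbit_shift[OF y, of 0 "q * N"] nqr by auto
      obtain c where c: "c \<in> (F ^^ N) ` half_open_square" "dist c p \<le> \<delta> / 3 * real N"
        using n0[OF _ p(1)] N by auto
      have "dist (y (q * N + r)) (y (q * N + 0)) \<le> real r * (M + e)"
        using pseudo_orbit_displacement_le[OF pseudo_orbit_shift[OF y, of "q * N" r] M(2)] nqr
        by simp
      also have "\<dots> \<le> real N * (M + 1)" using rN M e by (intro mult_mono) auto
      finally have rest: "norm (y n - y (q * N)) \<le> real N * (M + 1)"
        by (simp add: nqr dist_norm)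
      have "norm ((real r / real N) *\<^sub>R c) \<le> 1 * norm c"
        unfolding norm_scaleR using rN N by (intro mult_right_mono) (auto simp: divide_le_eq)
      hence rc: "norm ((real r / real N) *\<^sub>R c) \<le> real N * M + 2"
        using iterated_square_norm_le[OF M(2) c(1)] by simp
      \<comment> \<open>The four parts of \<open>split\<close> below: error of the complete blocks, distance from the convex
        hull, incomplete last block, and the change of the time scale from \<open>q * N\<close> to \<open>n\<close>.\<close>
      have qp: "norm (real q *\<^sub>R (p - c)) \<le> real q * (\<delta> / 3 * real N)"
        unfolding norm_scaleR using c(2) by (intro mult_mono) (auto simp: dist_norm norm_minus_commute)
      have "real n / real N = real q + real r / real N"
        using N by (simp add: nqr add_divide_distrib)
      hence split: "y n - y 0 - (real n / real N) *\<^sub>R c =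
          (y (q * N) - y 0 - real q *\<^sub>R p) + real q *\<^sub>R (p - c)
            + (y n - y (q * N)) - (real r / real N) *\<^sub>R c"
        by (simp add: algebra_simps)
      have "norm (y n - y 0 - (real n / real N) *\<^sub>R c) \<le>
          3 * real q + real q * (\<delta> / 3 * real N) + real N * (M + 1) + (real N * M + 2)"
        unfolding split using p(2) qp rest rc unfolding dist_norm
        by (intro order_trans[OF norm_triangle_ineq4 add_mono] norm_triangle_mono)
      also have "\<dots> = 3 * real q + \<delta> / 3 * real (q * N) + (real N * (2 * M + 1) + 2)"
        by (simp add: algebra_simps)
      also have "\<dots> \<le> \<delta> / 3 * real n + \<delta> / 3 * real n + \<delta> / 3 * real n"
      proof (intro add_mono)
        have "9 \<le> \<delta> * real N"
        proof -
          have "9 \<le> \<delta> * real n2" using n2 \<delta> by (simp add: field_simps)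
          also have "\<dots> \<le> \<delta> * real N" using N \<delta> by (intro mult_left_mono) auto
          finally show ?thesis .
        qed
        hence "real q * 9 \<le> real q * (\<delta> * real N)" by (intro mult_left_mono) auto
        also have "\<dots> = \<delta> * real (q * N)" by simp
        also have "\<dots> \<le> \<delta> * real n" using \<delta> nqr by (intro mult_left_mono) auto
        finally show "3 * real q \<le> \<delta> / 3 * real n" by simp
        show "\<delta> / 3 * real (q * N) \<le> \<delta> / 3 * real n" using \<delta> nqr by (intro mult_left_mono) auto
        have "3 * (real N * (2 * M + 1) + 2) \<le> \<delta> * real n1" using n1 \<delta> by (simp add: field_simps)
        also have "\<dots> \<le> \<delta> * real n" using n \<delta> by (intro mult_left_mono) auto
        finally show "real N * (2 * M + 1) + 2 \<le> \<delta> / 3 * real n" by simp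
      qed
      also have "\<dots> = \<delta> * real n" by simp
      finally have bound: "norm (y n - y 0 - (real n / real N) *\<^sub>R c) \<le> \<delta> * real n" .
      have "(y n - y 0) /\<^sub>R real n - c /\<^sub>R real N
          = (y n - y 0 - (real n / real N) *\<^sub>R c) /\<^sub>R real n"
        using n by (simp add: algebra_simps divide_inverse)
      hence "dist ((y n - y 0) /\<^sub>R real n) (c /\<^sub>R real N)
          = norm (y n - y 0 - (real n / real N) *\<^sub>R c) / real n"
        by (simp add: dist_norm divide_inverse)
      also have "\<dots> \<le> \<delta>" using bound n by (simp add: divide_le_eq)
      finally show "\<exists>c\<in>(F ^^ N) ` half_open_square.
          dist ((y n - y 0) /\<^sub>R real n) (c /\<^sub>R real N) \<le> \<delta>" using c(1) by blast
    qed
  qed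
qed

section \<open>Approximation of the rotation set\<close>

text \<open>True orbits are pseudo-orbits. So although a rotation vector is only known as a limit along some
  sequence of times, the speed estimate brings it close to \<open>F\<^sup>N(D)/N\<close> for all large \<open>N\<close>.\<close>
lemma rotation_set_near_iterated_square:
  assumes F: "F \<in> torus_lifts" and L: "L-lipschitz_on UNIV F" "1 \<le> L" and \<delta>: "0 < \<delta>"
  shows "\<exists>N0. \<forall>N\<ge>N0. \<forall>v\<in>rotation_set F. \<exists>c\<in>(F ^^ N) ` half_open_square.
           dist v (c /\<^sub>R real N) \<le> \<delta>"
proof -
  obtain N0 where N0: "\<And>N. N0 \<le> N \<Longrightarrow> \<exists>e>0. \<exists>n1. \<forall>y n. n1 \<le> n \<and> pseudo_orbit F e y n \<longrightarrow>
      (\<exists>c\<in>(F ^^ N) ` half_open_square. dist ((y n - y 0) /\<^sub>R real n) (c /\<^sub>R real N) \<le> \<delta> / 2)"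
    using pseudo_orbit_speed[OF F L, of "\<delta> / 2"] \<delta> by auto
  show ?thesis
  proof (intro exI allI impI ballI)
    fix N v assume N: "N0 \<le> N" and v: "v \<in> rotation_set F"
    obtain e n1 where e: "e > 0" and n1: "\<And>y n. n1 \<le> n \<Longrightarrow> pseudo_orbit F e y n \<Longrightarrow>
      (\<exists>c\<in>(F ^^ N) ` half_open_square. dist ((y n - y 0) /\<^sub>R real n) (c /\<^sub>R real N) \<le> \<delta> / 2)"
      using N0[OF N] by blast
    obtain n :: "nat \<Rightarrow> nat" and x where nx: "filterlim n at_top sequentially"
      "(\<lambda>i. ((F ^^ n i) (x i) - x i) /\<^sub>R real (n i)) \<longlonglongrightarrow> v"
      using v by (auto simp: rotation_set_def)
    have "\<forall>\<^sub>F i in sequentially. n1 \<le> n i" using nx(1) by (simp add: filterlim_at_top)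
    moreover have "\<forall>\<^sub>F i in sequentially. dist (((F ^^ n i) (x i) - x i) /\<^sub>R real (n i)) v < \<delta> / 2"
      using nx(2) \<delta> by (intro tendstoD) auto
    ultimately have "\<forall>\<^sub>F i in sequentially. n1 \<le> n i \<and>
        dist (((F ^^ n i) (x i) - x i) /\<^sub>R real (n i)) v < \<delta> / 2"
      by eventually_elim simp
    then obtain i where i: "n1 \<le> n i" "dist (((F ^^ n i) (x i) - x i) /\<^sub>R real (n i)) v < \<delta> / 2"
      by (auto simp: eventually_sequentially)
    obtain c where "c \<in> (F ^^ N) ` half_open_square"
      "dist (((F ^^ n i) (x i) - x i) /\<^sub>R real (n i)) (c /\<^sub>R real N) \<le> \<delta> / 2"
      using n1[OF i(1) orbit_is_pseudo_orbit[of e F "x i" "n i"]] e by auto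
    with i(2) show "\<exists>c\<in>(F ^^ N) ` half_open_square. dist v (c /\<^sub>R real N) \<le> \<delta>"
      using dist_triangle3[of v "c /\<^sub>R real N" "((F ^^ n i) (x i) - x i) /\<^sub>R real (n i)"]
      by (intro bexI[of _ c]) auto
  qed
qed

text \<open>Compactness: otherwise there are points \<open>x\<close> of the square and arbitrarily large times \<open>N\<close>
  with \<open>F\<^sup>N(x)/N\<close> far from the rotation set. These vectors are bounded and have a limit
  point, which is a rotation vector since \<open>x/N\<close> tends to zero.\<close>
lemma iterated_square_near_rotation_set:
  assumes F: "F \<in> torus_lifts" and \<delta>: "0 < \<delta>"
  shows "\<exists>N0. \<forall>N\<ge>N0. \<forall>c\<in>(F ^^ N) ` half_open_square. \<exists>v\<in>rotation_set F.
           dist (c /\<^sub>R real N) v \<le> \<delta>"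
proof (rule ccontr)
  assume neg: "\<not> ?thesis"
  define S where "S = {N. \<exists>x\<in>half_open_square. \<forall>v\<in>rotation_set F.
      \<delta> < dist ((F ^^ N) x /\<^sub>R real N) v}"
  have "\<exists>N\<ge>N0. N \<in> S" for N0
    using neg unfolding S_def by (auto simp: not_le)
  hence inf: "infinite S" by (auto simp: infinite_nat_iff_unbounded_le)
  \<comment> \<open>Enumerating the bad times makes the sequence of times increasing, as the definition of the
    rotation set demands.\<close>
  define N where "N = enumerate S"
  have mono: "strict_mono N" unfolding N_def by (rule strict_mono_enumerate[OF inf])
  have "N i \<in> S" for i unfolding N_def by (rule enumerate_in_set[OF inf])
  then obtain x where x: "\<And>i. x i \<in> half_open_square"
    and far: "\<And>i v. v \<in> rotation_set F \<Longrightarrow> \<delta> < dist ((F ^^ N i) (x i) /\<^sub>R real (N i)) v"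
    unfolding S_def mem_Collect_eq by metis
  obtain M where M: "0 \<le> M" "\<And>x. dist (F x) x \<le> M" by (rule displacement_bounded[OF F]) auto
  define z where "z = (\<lambda>i. (F ^^ N i) (x i) /\<^sub>R real (N i))"
  have "norm (z i) \<le> M + 2" for i
  proof (cases "N i = 0")
    case False
    have "norm ((F ^^ N i) (x i)) \<le> real (N i) * M + 2"
      using x by (intro iterated_square_norm_le[OF M(2)]) auto
    also have "\<dots> \<le> real (N i) * (M + 2)" using False by (simp add: algebra_simps)
    finally show ?thesis using False by (simp add: z_def field_simps)
  qed (use M in \<open>auto simp: z_def\<close>)
  hence "bounded (range z)" by (auto simp: bounded_iff)
  then obtain v and s :: "nat \<Rightarrow> nat" where s: "strict_mono s" "(z \<circ> s) \<longlonglongrightarrow> v"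
    using bounded_imp_convergent_subsequence by metis
  have Ns: "strict_mono (N \<circ> s)" by (rule strict_mono_o[OF mono s(1)])
  hence lim: "filterlim (N \<circ> s) at_top sequentially" by (rule filterlim_subseq)
  have "(\<lambda>i. x (s i) /\<^sub>R real ((N \<circ> s) i)) \<longlonglongrightarrow> 0"
  proof (rule Lim_null_comparison)
    show "\<forall>\<^sub>F i in sequentially. norm (x (s i) /\<^sub>R real ((N \<circ> s) i)) \<le> 2 * inverse (real ((N \<circ> s) i))"
      using x half_open_square_subset norm_unit_square
      by (intro always_eventually allI) (auto simp: mult.commute intro!: mult_right_mono)
    have "filterlim (\<lambda>i. real ((N \<circ> s) i)) at_top sequentially"
      by (rule filterlim_compose[OF filterlim_real_sequentially lim])
    thus "(\<lambda>i. 2 * inverse (real ((N \<circ> s) i))) \<longlonglongrightarrow> 0"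
      by (intro tendsto_mult_right_zero tendsto_inverse_0_at_top)
  qed
  from tendsto_diff[OF s(2) this]
  have "(\<lambda>i. ((F ^^ (N \<circ> s) i) (x (s i)) - x (s i)) /\<^sub>R real ((N \<circ> s) i)) \<longlonglongrightarrow> v"
    by (simp add: z_def scaleR_diff_right)
  hence "v \<in> rotation_set F"
    unfolding rotation_set_def using lim strict_mono_mono[OF Ns]
    by (intro CollectI exI[of _ "N \<circ> s"] exI[of _ "\<lambda>i. x (s i)"] conjI)
  hence "\<delta> < dist ((z \<circ> s) i) v" for i using far by (simp add: z_def)
  moreover have "\<forall>\<^sub>F i in sequentially. dist ((z \<circ> s) i) v < \<delta>" using s(2) \<delta> by (rule tendstoD)
  ultimately show False by (auto simp: eventually_sequentially intro: less_asym)
qed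

section \<open>Box images and pseudo-orbits\<close>

lemma box_translates_cover:
  assumes "box_cover \<epsilon> \<B>\<^sub>0"
  obtains B where "B \<in> box_translates \<B>\<^sub>0" "x \<in> B"
proof -
  obtain d k where dk: "d \<in> half_open_square" "k \<in> int_lattice" "x = d + k"
    by (rule lattice_decomposition)
  then obtain B where "B \<in> \<B>\<^sub>0" "d \<in> B"
    using assms half_open_square_subset unfolding box_cover_def by blast
  hence "(+) k ` B \<in> box_translates \<B>\<^sub>0" "x \<in> (+) k ` B"
    using dk by (auto simp: box_translates_def)
  thus ?thesis by (rule that)
qed

lemma box_translates_small:
  assumes c: "box_cover \<epsilon> \<B>\<^sub>0" and B: "B \<in> box_translates \<B>\<^sub>0"
  shows "compact B" "\<And>p q. p \<in> B \<Longrightarrow> q \<in> B \<Longrightarrow> dist p q \<le> \<epsilon>"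
proof -
  obtain t C where C: "C \<in> \<B>\<^sub>0" "B = (+) t ` C" using B by (auto simp: box_translates_def)
  hence *: "compact C" "diameter C \<le> \<epsilon>" using c by (auto simp: box_cover_def)
  show "compact B" unfolding C by (rule compact_translation[OF *(1)])
  show "dist p q \<le> \<epsilon>" if pq: "p \<in> B" "q \<in> B" for p q
    using that *(2) diameter_bounded_bound[OF compact_imp_bounded[OF *(1)]]
    unfolding C(2) by (force simp: dist_norm)
qed

lemma box_level_subset:
  "box_level F R \<B>\<^sub>0 \<Gamma> n \<subseteq> box_translates \<B>\<^sub>0"
proof (cases n)
  case 0
  have "B \<in> box_translates \<B>\<^sub>0" if "B \<in> \<B>\<^sub>0" for B
    unfolding box_translates_def using that
    by (auto intro!: exI[of _ 0] exI[of _ B] simp: int_lattice_def)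
  with 0 show ?thesis by auto
qed auto

lemma box_union_eq: "box_cover \<epsilon> \<B>\<^sub>0 \<Longrightarrow> box_union F R \<B>\<^sub>0 \<Gamma> n = \<Union>(box_level F R \<B>\<^sub>0 \<Gamma> n)"
  by (cases n) (auto simp: box_cover_def)

text \<open>If the orbit point lies in a box, a grid point within \<open>\<eta>\<close> of it has its image within
  \<open>L * \<eta> \<le> R\<close> of the next orbit point, so every box containing that point is hit.\<close>
lemma orbit_in_box_union:
  assumes c: "box_cover \<epsilon> \<B>\<^sub>0" and g: "grid_choice \<eta> \<B>\<^sub>0 \<Gamma>"
    and L: "L-lipschitz_on UNIV F" "L * \<eta> \<le> R" and x: "x \<in> unit_square"
  shows "(F ^^ n) x \<in> box_union F R \<B>\<^sub>0 \<Gamma> n"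
proof -
  have "\<exists>B\<in>box_level F R \<B>\<^sub>0 \<Gamma> n. (F ^^ n) x \<in> B"
  proof (induction n)
    case 0
    show ?case using c x by (auto simp: box_cover_def)
  next
    case (Suc n)
    then obtain B where B: "B \<in> box_level F R \<B>\<^sub>0 \<Gamma> n" "(F ^^ n) x \<in> B" by blast
    hence "B \<in> box_translates \<B>\<^sub>0" using box_level_subset by blast
    then obtain y where y: "y \<in> \<Gamma> B" "dist ((F ^^ n) x) y \<le> \<eta>"
      using g B(2) unfolding grid_choice_def by blast
    obtain B' where B': "B' \<in> box_translates \<B>\<^sub>0" "(F ^^ Suc n) x \<in> B'"
      by (rule box_translates_cover[OF c])
    have "infdist (F y) B' \<le> dist (F y) (F ((F ^^ n) x))" using B'(2) by (intro infdist_le) simp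
    also have "\<dots> \<le> L * dist y ((F ^^ n) x)" by (rule lipschitz_onD[OF L(1)]) auto
    also have "\<dots> \<le> L * \<eta>"
      using y(2) lipschitz_on_nonneg[OF L(1)] by (intro mult_left_mono) (auto simp: dist_commute)
    finally have "B' \<in> box_image F R \<B>\<^sub>0 \<Gamma> B"
      using L(2) y B' by (auto simp: box_image_def intro!: bexI[of _ y])
    thus ?case using B(1) B' by auto
  qed
  thus ?thesis using box_union_eq[OF c] by auto
qed

text \<open>The grid points that witness the successive hits form the pseudo-orbit: a jump consists of a
  step of length at most \<open>R\<close> into the next box and a move inside that box.\<close>
lemma box_union_reached_by_pseudo_orbit:
  assumes c: "box_cover \<epsilon> \<B>\<^sub>0" and g: "grid_choice \<eta> \<B>\<^sub>0 \<Gamma>"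
    and p: "p \<in> box_union F R \<B>\<^sub>0 \<Gamma> n"
  shows "\<exists>y. pseudo_orbit F (R + \<epsilon>) y n \<and> y 0 \<in> unit_square \<and> y n = p"
proof -
  obtain B where "B \<in> box_level F R \<B>\<^sub>0 \<Gamma> n" "p \<in> B" using p box_union_eq[OF c] by auto
  thus ?thesis
  proof (induction n arbitrary: B p)
    case 0
    hence "p \<in> unit_square" using c by (auto simp: box_cover_def)
    thus ?case by (intro exI[of _ "\<lambda>_. p"]) (auto simp: pseudo_orbit_def)
  next
    case (Suc n)
    then obtain A x where A: "A \<in> box_level F R \<B>\<^sub>0 \<Gamma> n" "x \<in> \<Gamma> A" "infdist (F x) B \<le> R"
      and B: "B \<in> box_translates \<B>\<^sub>0" "B \<noteq> {}"
      by (auto simp: box_image_def)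
    have "x \<in> A" using A box_level_subset g unfolding grid_choice_def by blast
    then obtain y where y: "pseudo_orbit F (R + \<epsilon>) y n" "y 0 \<in> unit_square" "y n = x"
      using Suc.IH[OF A(1)] by blast
    obtain b where b: "b \<in> B" "infdist (F x) B = dist (F x) b"
      using infdist_attains_inf[OF compact_imp_closed[OF box_translates_small(1)[OF c B(1)]] B(2)]
      by blast
    have "dist (F x) p \<le> R + \<epsilon>"
      using A(3) b box_translates_small(2)[OF c B(1) b(1) Suc.prems(2)] dist_triangle[of "F x" p b]
      by linarith
    hence "pseudo_orbit F (R + \<epsilon>) (y(Suc n := p)) (Suc n)"
      using y by (auto simp: pseudo_orbit_def less_Suc_eq)
    moreover have "(y(Suc n := p)) 0 \<in> unit_square" "(y(Suc n := p)) (Suc n) = p" using y(2) by auto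
    ultimately show ?case by blast
  qed
qed

section \<open>Convergence of the box algorithm\<close>

lemma hausdorff_distance_le:
  assumes "\<And>a. a \<in> A \<Longrightarrow> \<exists>b\<in>B. dist a b \<le> r" "\<And>b. b \<in> B \<Longrightarrow> \<exists>a\<in>A. dist a b \<le> r"
  shows "hausdorff_distance A B \<le> ennreal r"
  unfolding hausdorff_distance_def
proof (intro max.boundedI SUP_least)
  fix a assume "a \<in> A"
  then obtain b where "b \<in> B" "dist a b \<le> r" using assms(1) by blast
  thus "(INF b\<in>B. ennreal (dist a b)) \<le> ennreal r" by (intro INF_lower2 ennreal_leI)
next
  fix b assume "b \<in> B"
  then obtain a where "a \<in> A" "dist a b \<le> r" using assms(2) by blast
  thus "(INF a\<in>A. ennreal (dist a b)) \<le> ennreal r" by (intro INF_lower2 ennreal_leI)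
qed

theorem theorem11:
  fixes F :: "real^2 \<Rightarrow> real^2" and L :: real and \<eta> R :: "real \<Rightarrow> real"
  assumes "F \<in> torus_lifts"
    and "L > 1" and "L-lipschitz_on UNIV F"
    and "\<And>\<epsilon>. \<epsilon> > 0 \<Longrightarrow> \<eta> \<epsilon> > 0 \<and> R \<epsilon> > 0 \<and> L * \<eta> \<epsilon> \<le> R \<epsilon> \<and> R \<epsilon> \<le> \<epsilon>"
  shows "\<forall>\<delta>>0. \<exists>\<epsilon>\<^sub>0>0. \<exists>n\<^sub>0::nat. \<forall>\<epsilon>\<in>{0<..\<epsilon>\<^sub>0}. \<forall>\<B>\<^sub>0 \<Gamma>.
           box_cover \<epsilon> \<B>\<^sub>0 \<and> grid_choice (\<eta> \<epsilon>) \<B>\<^sub>0 \<Gamma> \<longrightarrow>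
           (\<forall>n\<ge>n\<^sub>0. hausdorff_distance (scaled_box_union F (R \<epsilon>) \<B>\<^sub>0 \<Gamma> n) (rotation_set F)
                     < ennreal \<delta>)"
proof (intro allI impI)
  fix \<delta> :: real assume \<delta>: "0 < \<delta>"
  have L: "1 \<le> L" using assms(2) by simp
  define d where "d = \<delta> / 4"
  have d: "0 < d" using \<delta> by (simp add: d_def)
  obtain N1 where N1: "\<And>N. N1 \<le> N \<Longrightarrow> \<exists>e>0. \<exists>n1. \<forall>y n. n1 \<le> n \<and> pseudo_orbit F e y n \<longrightarrow>
      (\<exists>c\<in>(F ^^ N) ` half_open_square. dist ((y n - y 0) /\<^sub>R real n) (c /\<^sub>R real N) \<le> d)"
    using pseudo_orbit_speed[OF assms(1,3) L d] by blast
  obtain N2 where N2: "\<And>N c. N2 \<le> N \<Longrightarrow> c \<in> (F ^^ N) ` half_open_square \<Longrightarrow>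
      \<exists>v\<in>rotation_set F. dist (c /\<^sub>R real N) v \<le> d"
    using iterated_square_near_rotation_set[OF assms(1) d] by blast
  obtain N3 where N3: "\<And>N v. N3 \<le> N \<Longrightarrow> v \<in> rotation_set F \<Longrightarrow>
      \<exists>c\<in>(F ^^ N) ` half_open_square. dist v (c /\<^sub>R real N) \<le> d"
    using rotation_set_near_iterated_square[OF assms(1,3) L d] by blast
  \<comment> \<open>The block length \<open>N\<close> is fixed before the jump size \<open>e\<close> and the time \<open>n1\<close>; hence
    neither depends on the parameters of the box algorithm.\<close>
  define N where "N = max N1 N2"
  obtain e n1 where e: "0 < e" and n1: "\<And>y n. n1 \<le> n \<Longrightarrow> pseudo_orbit F e y n \<Longrightarrow>
      \<exists>c\<in>(F ^^ N) ` half_open_square. dist ((y n - y 0) /\<^sub>R real n) (c /\<^sub>R real N) \<le> d"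
    using N1[of N] unfolding N_def by (metis max.cobounded1)
  obtain n2 :: nat where n2: "2 / d < n2" using reals_Archimedean2 by blast
  show "\<exists>\<epsilon>\<^sub>0>0. \<exists>n\<^sub>0::nat. \<forall>\<epsilon>\<in>{0<..\<epsilon>\<^sub>0}. \<forall>\<B>\<^sub>0 \<Gamma>.
           box_cover \<epsilon> \<B>\<^sub>0 \<and> grid_choice (\<eta> \<epsilon>) \<B>\<^sub>0 \<Gamma> \<longrightarrow>
           (\<forall>n\<ge>n\<^sub>0. hausdorff_distance (scaled_box_union F (R \<epsilon>) \<B>\<^sub>0 \<Gamma> n) (rotation_set F)
                     < ennreal \<delta>)"
  proof (intro exI[of _ "e / 2"] conjI exI[of _ "max (max n1 n2) (max 1 N3)"] ballI allI impI)
    fix \<epsilon> \<B>\<^sub>0 \<Gamma> n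
    assume \<epsilon>: "\<epsilon> \<in> {0<..e / 2}" and box: "box_cover \<epsilon> \<B>\<^sub>0 \<and> grid_choice (\<eta> \<epsilon>) \<B>\<^sub>0 \<Gamma>"
      and n: "max (max n1 n2) (max 1 N3) \<le> n"
    have R: "L * \<eta> \<epsilon> \<le> R \<epsilon>" "R \<epsilon> + \<epsilon> \<le> e" using assms(4)[of \<epsilon>] \<epsilon> by auto
    have "hausdorff_distance (scaled_box_union F (R \<epsilon>) \<B>\<^sub>0 \<Gamma> n) (rotation_set F) \<le> ennreal (3 * d)"
    proof (rule hausdorff_distance_le)
      fix a assume "a \<in> scaled_box_union F (R \<epsilon>) \<B>\<^sub>0 \<Gamma> n"
      then obtain p where p: "p \<in> box_union F (R \<epsilon>) \<B>\<^sub>0 \<Gamma> n" "a = p /\<^sub>R real n"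
        by (auto simp: scaled_box_union_def)
      then obtain y where y: "pseudo_orbit F (R \<epsilon> + \<epsilon>) y n" "y 0 \<in> unit_square" "y n = p"
        using box_union_reached_by_pseudo_orbit box by blast
      have "pseudo_orbit F e y n" using y(1) R(2) unfolding pseudo_orbit_def by fastforce
      then obtain c where c: "c \<in> (F ^^ N) ` half_open_square"
        "dist ((y n - y 0) /\<^sub>R real n) (c /\<^sub>R real N) \<le> d"
        using n1[of n y] n by auto
      obtain v where v: "v \<in> rotation_set F" "dist (c /\<^sub>R real N) v \<le> d"
        using N2[OF _ c(1)] by (auto simp: N_def)
      have "a - (y n - y 0) /\<^sub>R real n = y 0 /\<^sub>R real n" using p y by (simp add: algebra_simps)
      hence "dist a ((y n - y 0) /\<^sub>R real n) = norm (y 0) / real n"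
        by (simp add: dist_norm divide_inverse mult.commute)
      also have "\<dots> \<le> 2 / real n" using norm_unit_square[OF y(2)] by (intro divide_right_mono) auto
      also have "\<dots> \<le> d"
      proof -
        have "2 \<le> d * real n2" using n2 d by (simp add: field_simps)
        also have "\<dots> \<le> d * real n" using n d by (intro mult_left_mono) auto
        finally show ?thesis using n by (simp add: divide_le_eq)
      qed
      finally have "dist a v \<le> d + d + d"
        using c(2) v(2) by metric
      thus "\<exists>v\<in>rotation_set F. dist a v \<le> 3 * d" using v by auto
    next
      fix v assume "v \<in> rotation_set F"
      then obtain x where x: "x \<in> half_open_square" "dist v ((F ^^ n) x /\<^sub>R real n) \<le> d"
        using N3[of n v] n by auto
      have "(F ^^ n) x \<in> box_union F (R \<epsilon>) \<B>\<^sub>0 \<Gamma> n"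
        using orbit_in_box_union[OF _ _ assms(3) R(1)] box x half_open_square_subset by blast
      hence "(F ^^ n) x /\<^sub>R real n \<in> scaled_box_union F (R \<epsilon>) \<B>\<^sub>0 \<Gamma> n"
        by (auto simp: scaled_box_union_def)
      moreover have "dist ((F ^^ n) x /\<^sub>R real n) v \<le> 3 * d" using x(2) d by (simp add: dist_commute)
      ultimately show "\<exists>a\<in>scaled_box_union F (R \<epsilon>) \<B>\<^sub>0 \<Gamma> n. dist a v \<le> 3 * d" by blast
    qed
    also have "ennreal (3 * d) < ennreal \<delta>" using \<delta> by (intro ennreal_lessI) (auto simp: d_def)
    finally show "hausdorff_distance (scaled_box_union F (R \<epsilon>) \<B>\<^sub>0 \<Gamma> n) (rotation_set F)
        < ennreal \<delta>" .
  qed (use e in auto)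
qed

end
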